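(* Let $X$ be an infinite Tychonoff space and let $G$ be a non-trivial metrizable arc-connected topological group. Then the following are equivalent: (a) Player II has a winning strategy in the $\Omega$-Menger game $G_{fin}(\Omega(X),\Omega(X))$. (b) Player II has a winning strategy in the countable fan tightness game $CFT(C_p(X,G),\mathbf{e})$.
   Context: Tychonoff means completely regular Hausdorff. $G$ has identity element $e$; arc-connected means that for any two distinct points of $G$ there is a topological embedding $[0,1]\hookrightarrow G$ joining them (in particular for each $g\in G\setminus\{e\}$ there is an embedding $\gamma:[0,1]\hookrightarrow G$ with $\gamma(0)=e$, $\gamma(1)=g$). $C_p(X,G)$ is the space of all continuous functions $X\to G$ with the topology of pointwise convergence, and $\mathbf{e}\in C_p(X,G)$ is the constant function with value $e$. An open cover $\mathcal{U}$ of $X$ is an $\omega$-cover if $X\notin\mathcal{U}$ and every finite subset of $X$ is contained in some member of $\mathcal{U}$; $\Omega(X)$ is the collection of all $\omega$-covers of $X$. For a space $Y$ and $y\in Y$, $\Omega_y=\{A\subset Y: y\in\overline{A}\setminus A\}$. For collections $\mathcal{A},\mathcal{B}$ of subsets of an infinite set, the game $G_{fin}(\mathcal{A},\mathcal{B})$ is played in innings $n\in\mathbb{N}=\{1,2,\dots\}$: in inning $n$ Player I selects $A_n\in\mathcal{A}$ and Player II responds with a finite subset $B_n\subset A_n$. Player II wins if $\bigcup_{n}B_n\in\mathcal{B}$; otherwise Player I wins. A strategy for Player II is a function $\sigma$ on $\bigcup_{n\ge1}\mathcal{A}^n$ with $\sigma(A_1,\dots,A_n)$ a finite subset of $A_n$;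 it is winning if, for every sequence $(A_n)_{n}$ of elements of $\mathcal{A}$ played by Player I, Player II wins by responding with $B_n=\sigma(A_1,\dots,A_n)$ in each inning $n$. The countable fan tightness game is $CFT(Y,y):=G_{fin}(\Omega_y,\Omega_y)$: in inning $n$ Player I chooses $A_n\subset Y\setminus\{y\}$ with $y\in\overline{A_n}$, Player II chooses a finite $B_n\subset A_n$, and Player II wins if $y\in\overline{\bigcup_{n}B_n}$. *)

theory Defs
  imports "HOL-Analysis.Analysis"
begin

definition Tychonoff_space :: "'a topology \<Rightarrow> bool" where
  "Tychonoff_space X \<longleftrightarrow> completely_regular_space X \<and> Hausdorff_space X"

definition arc_connected_space :: "'a topology \<Rightarrow> bool" where
  "arc_connected_space T \<longleftrightarrow>
     (\<forall>x\<in>topspace T. \<forall>y\<in>topspace T. x \<noteq> y \<longrightarrow>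
        (\<exists>\<gamma>::real \<Rightarrow> 'a. embedding_map (top_of_set {0..1}) T \<gamma> \<and> \<gamma> 0 = x \<and> \<gamma> 1 = y))"

(* The topology of pointwise convergence is the one induced by the power topology.  Points of a
   product_topology are extensional functions, so each continuous function on X occurs once,
   represented by the function that is "undefined" outside topspace X. *)
definition Cp :: "'a topology \<Rightarrow> 'b topology \<Rightarrow> ('a \<Rightarrow> 'b) topology" where
  "Cp X T = subtopology (product_topology (\<lambda>_. T) (topspace X)) {f. continuous_map X T f}"

definition Cp_const :: "'a topology \<Rightarrow> 'b \<Rightarrow> 'a \<Rightarrow> 'b" where
  "Cp_const X c = (\<lambda>x\<in>topspace X. c)"

lemma topspace_Cp:
  "topspace (Cp X T) = {f \<in> extensional (topspace X). continuous_map X T f}"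
  by (auto simp: Cp_def PiE_def dest: continuous_map_funspace)

lemma Cp_const_in_Cp:
  assumes "c \<in> topspace T"
  shows "Cp_const X c \<in> topspace (Cp X T)"
proof -
  have "continuous_map X T (\<lambda>x\<in>topspace X. c)"
    using assms by (auto intro: continuous_map_eq[of X T "\<lambda>_. c"])
  then show ?thesis
    by (simp add: topspace_Cp Cp_const_def)
qed

definition omega_covers :: "'a topology \<Rightarrow> 'a set set set" where
  "omega_covers X =
     {\<U>. (\<forall>U\<in>\<U>. openin X U) \<and> \<Union>\<U> = topspace X \<and> topspace X \<notin> \<U> \<and>
          (\<forall>F. finite F \<and> F \<subseteq> topspace X \<longrightarrow> (\<exists>U\<in>\<U>. F \<subseteq> U))}"

definition Omega_at :: "'a topology \<Rightarrow> 'a \<Rightarrow> 'a set set" where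
  "Omega_at Y y = {A. A \<subseteq> topspace Y \<and> y \<in> (Y closure_of A) - A}"

(* The selection game G_fin(\<A>, \<B>).  A strategy of Player II is evaluated on the nonempty list
   [A_1, ..., A_n] of the moves made so far by Player I, most recent move last; its values on
   other lists are irrelevant. *)
definition Gfin_strategy_II :: "'m set set \<Rightarrow> ('m set list \<Rightarrow> 'm set) \<Rightarrow> bool" where
  "Gfin_strategy_II \<A> \<sigma> \<longleftrightarrow>
     (\<forall>As. As \<noteq> [] \<and> set As \<subseteq> \<A> \<longrightarrow> finite (\<sigma> As) \<and> \<sigma> As \<subseteq> last As)"

(* Innings are numbered from 0: A n is the move of Player I in inning n + 1. *)
definition Gfin_winning_strategy_II ::
  "'m set set \<Rightarrow> 'm set set \<Rightarrow> ('m set list \<Rightarrow> 'm set) \<Rightarrow> bool" where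
  "Gfin_winning_strategy_II \<A> \<B> \<sigma> \<longleftrightarrow>
     Gfin_strategy_II \<A> \<sigma> \<and>
     (\<forall>A::nat \<Rightarrow> 'm set. (\<forall>n. A n \<in> \<A>) \<longrightarrow> (\<Union>n. \<sigma> (map A [0..<Suc n])) \<in> \<B>)"

definition Gfin_II_has_winning_strategy :: "'m set set \<Rightarrow> 'm set set \<Rightarrow> bool" where
  "Gfin_II_has_winning_strategy \<A> \<B> \<longleftrightarrow> (\<exists>\<sigma>. Gfin_winning_strategy_II \<A> \<B> \<sigma>)"

definition CFT_II_has_winning_strategy :: "'a topology \<Rightarrow> 'a \<Rightarrow> bool" where
  "CFT_II_has_winning_strategy Y y \<longleftrightarrow>
     Gfin_II_has_winning_strategy (Omega_at Y y) (Omega_at Y y)"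

end

theory Submission
  imports Defs
begin

text \<open>
  From a set \<open>A\<close> of functions accumulating at the constant \<open>c\<close> and a neighbourhood \<open>W\<close> of \<open>c\<close>, one obtains the
  \<open>\<omega>\<close>-cover of all proper open sets that some member of \<open>A\<close> maps into \<open>W\<close>; shrinking \<open>W\<close> along
  a countable base at \<open>c\<close> from inning to inning transfers a strategy for the covering game to the
  function space. Conversely, an \<open>\<omega>\<close>-cover \<open>\<U>\<close> yields the set of all functions that take a fixed
  value \<open>g \<noteq> c\<close> outside some member of \<open>\<U>\<close>; complete regularity and a path from \<open>c\<close> to \<open>g\<close>
  make it accumulate at the constant \<open>c\<close>.
\<close>

section \<open>Accumulation at a constant function under pointwise convergence\<close>

text \<open>A basic neighbourhood restricts only finitely many coordinates. As the constant has the
  same value \<open>c\<close> at all of them, the finitely many open sets involved can be replaced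
  by their intersection, so one \<open>W\<close> serves for the whole of \<open>F\<close>.\<close>

lemma Cp_const_in_closure_iff:
  assumes c: "c \<in> topspace T" and A: "A \<subseteq> topspace (Cp X T)"
  shows "Cp_const X c \<in> Cp X T closure_of A \<longleftrightarrow>
         (\<forall>F W. finite F \<and> F \<subseteq> topspace X \<and> openin T W \<and> c \<in> W \<longrightarrow> (\<exists>f\<in>A. f ` F \<subseteq> W))"
    (is "?lhs \<longleftrightarrow> ?rhs")
proof
  assume L: ?lhs
  show ?rhs
  proof (intro allI impI)
    fix F W assume FW: "finite F \<and> F \<subseteq> topspace X \<and> openin T W \<and> c \<in> W"
    define P where "P = (\<Pi>\<^sub>E x\<in>topspace X. if x \<in> F then W else topspace T)"
    have "openin (product_topology (\<lambda>_. T) (topspace X)) P"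
      unfolding P_def
    proof (rule product_topology_basis)
      show "finite {i. (if i \<in> F then W else topspace T) \<noteq> topspace T}"
        by (rule finite_subset[of _ F]) (use FW in auto)
    qed (use FW in auto)
    then have "openin (Cp X T) (P \<inter> {f. continuous_map X T f})"
      unfolding Cp_def by (auto simp: openin_subtopology)
    moreover have "Cp_const X c \<in> P \<inter> {f. continuous_map X T f}"
      using Cp_const_in_Cp[OF c, of X] FW c
      by (auto simp: P_def topspace_Cp Cp_const_def)
    ultimately obtain f where f: "f \<in> A" "f \<in> P"
      using L unfolding in_closure_of by (metis IntD1)
    have "f x \<in> W" if "x \<in> F" for x
      using PiE_mem[OF f(2)[unfolded P_def], of x] FW that by auto
    then show "\<exists>f\<in>A. f ` F \<subseteq> W"
      using f(1) by blast
  qed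
next
  assume R: ?rhs
  show ?lhs
    unfolding in_closure_of
  proof (intro conjI allI impI)
    show "Cp_const X c \<in> topspace (Cp X T)"
      by (rule Cp_const_in_Cp[OF c])
  next
    fix N assume N: "Cp_const X c \<in> N \<and> openin (Cp X T) N"
    then obtain M where M: "openin (product_topology (\<lambda>_. T) (topspace X)) M"
      and NM: "N = M \<inter> {f. continuous_map X T f}"
      unfolding Cp_def by (auto simp: openin_subtopology)
    have "Cp_const X c \<in> M"
      using N NM by simp
    then obtain U where fin: "finite {i \<in> topspace X. U i \<noteq> topspace T}"
      and opn: "\<forall>i\<in>topspace X. openin T (U i)"
      and mem: "Cp_const X c \<in> PiE (topspace X) U" and sub: "PiE (topspace X) U \<subseteq> M"
      using M unfolding openin_product_topology_alt by blast
    define F where "F = {i \<in> topspace X. U i \<noteq> topspace T}"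
    \<comment> \<open>The factor \<open>topspace T\<close> matters when \<open>F\<close> is empty,
      since the intersection of the empty family is \<open>UNIV\<close>.\<close>
    define W where "W = topspace T \<inter> \<Inter>(U ` F)"
    have "openin T W"
      unfolding W_def using fin opn by (intro openin_Int_Inter) (auto simp: F_def)
    moreover have "c \<in> W"
      using mem c by (auto simp: W_def F_def Cp_const_def PiE_def Pi_def)
    moreover have "finite F" "F \<subseteq> topspace X"
      using fin by (auto simp: F_def)
    ultimately obtain f where f: "f \<in> A" "f ` F \<subseteq> W"
      using R by blast
    have fT: "f \<in> extensional (topspace X)" "continuous_map X T f"
      using f(1) A by (auto simp: topspace_Cp)
    have "f x \<in> U x" if x: "x \<in> topspace X" for x
    proof (cases "x \<in> F")
      case True
      then show ?thesis using f(2) by (auto simp: W_def)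
    next
      case False
      then have "U x = topspace T" using x by (simp add: F_def)
      then show ?thesis using continuous_map_funspace[OF fT(2)] x by auto
    qed
    then have "f \<in> N"
      using fT sub NM by (auto simp: PiE_def)
    then show "\<exists>y. y \<in> A \<and> y \<in> N"
      using f(1) by blast
  qed
qed

lemma Omega_at_Cp_const_iff:
  assumes "c \<in> topspace T"
  shows "A \<in> Omega_at (Cp X T) (Cp_const X c) \<longleftrightarrow>
         A \<subseteq> topspace (Cp X T) \<and> Cp_const X c \<notin> A \<and>
         (\<forall>F W. finite F \<and> F \<subseteq> topspace X \<and> openin T W \<and> c \<in> W \<longrightarrow> (\<exists>f\<in>A. f ` F \<subseteq> W))"
  by (cases "A \<subseteq> topspace (Cp X T)")
    (auto simp: Omega_at_def Cp_const_in_closure_iff[OF assms])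

lemma Omega_at_Cp_constE:
  assumes "A \<in> Omega_at (Cp X T) (Cp_const X c)" "c \<in> topspace T"
    and "finite F" "F \<subseteq> topspace X" "openin T W" "c \<in> W"
  obtains f where "f \<in> A" "f ` F \<subseteq> W"
  using assms by (metis Omega_at_Cp_const_iff)

section \<open>Finite sets and \<omega>-covers\<close>

text \<open>Applied to singletons, the clause on finite sets shows that the open sets in
  \<open>\<U>\<close> cover \<open>topspace X\<close>.\<close>

lemma omega_covers_iff:
  "\<U> \<in> omega_covers X \<longleftrightarrow>
     (\<forall>U\<in>\<U>. openin X U) \<and> topspace X \<notin> \<U> \<and>
     (\<forall>F. finite F \<and> F \<subseteq> topspace X \<longrightarrow> (\<exists>U\<in>\<U>. F \<subseteq> U))" (is "_ \<longleftrightarrow> ?R")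
proof
  assume R: ?R
  have "\<exists>U\<in>\<U>. x \<in> U" if "x \<in> topspace X" for x
    using R[THEN conjunct2, THEN conjunct2, rule_format, of "{x}"] that by simp
  moreover have "\<forall>U\<in>\<U>. U \<subseteq> topspace X"
    using R by (simp add: openin_subset)
  ultimately have "\<Union>\<U> = topspace X"
    by blast
  with R show "\<U> \<in> omega_covers X"
    by (simp add: omega_covers_def)
qed (simp add: omega_covers_def)

lemma omega_coversE:
  assumes "\<U> \<in> omega_covers X" "finite F" "F \<subseteq> topspace X"
  obtains U where "U \<in> \<U>" "F \<subseteq> U"
  using assms by (metis omega_covers_iff)

lemma omega_covers_proper_subset:
  assumes "\<U> \<in> omega_covers X" "U \<in> \<U>"
  shows "U \<subset> topspace X"
  using assms by (auto simp: omega_covers_iff dest: openin_subset)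

section \<open>From the covering game to the function space\<close>

text \<open>The preimage of \<open>W\<close> under a suitable \<open>f\<close> contains
  \<open>F\<close> but may be all of \<open>X\<close>. Removing one point outside \<open>F\<close>
  makes it proper: infinity of \<open>X\<close> supplies the point, and the T1 axiom keeps the
  remaining set open.\<close>

lemma omega_cover_of_Omega_at:
  assumes X: "infinite (topspace X)" "t1_space X"
    and c: "c \<in> topspace T"
    and A: "A \<in> Omega_at (Cp X T) (Cp_const X c)"
    and W: "openin T W" "c \<in> W"
  shows "{U. openin X U \<and> U \<noteq> topspace X \<and> (\<exists>f\<in>A. f ` U \<subseteq> W)} \<in> omega_covers X"
proof -
  have "\<exists>U. openin X U \<and> U \<noteq> topspace X \<and> (\<exists>f\<in>A. f ` U \<subseteq> W) \<and> F \<subseteq> U"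
    if F: "finite F" "F \<subseteq> topspace X" for F
  proof -
    obtain f where f: "f \<in> A" "f ` F \<subseteq> W"
      using Omega_at_Cp_constE[OF A c F W] .
    have "continuous_map X T f"
      using f(1) A by (auto simp: Omega_at_def topspace_Cp)
    then have "openin X {x \<in> topspace X. f x \<in> W}"
      using W(1) by (rule openin_continuous_map_preimage)
    moreover obtain x where x: "x \<in> topspace X" "x \<notin> F"
      using X(1) F(1) by (meson finite_subset subsetI)
    moreover have "closedin X {x}"
      using X(2) x(1) by (simp add: t1_space_closedin_singleton)
    ultimately have "openin X ({x \<in> topspace X. f x \<in> W} - {x})"
      by (intro openin_diff)
    then show ?thesis
      using f F x by (intro exI[of _ "{x \<in> topspace X. f x \<in> W} - {x}"]) blast
  qed
  then show ?thesis
    by (auto simp: omega_covers_iff)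
qed

text \<open>Player II turns each move into an \<omega>-cover, lets \<open>\<sigma>\<close> answer,
  and plays one witness function for each chosen set. A witness is close enough to \<open>c\<close>
  only if its set was chosen late, so the proof has to find a late set containing a given finite
  \<open>F\<close>.\<close>

lemma CFT_strategy_of_Menger_strategy:
  fixes X :: "'a topology" and T :: "'b topology"
  assumes X: "infinite (topspace X)" "t1_space X"
    and c: "c \<in> topspace T"
    and W: "\<And>n. openin T (W n)" "\<And>n. c \<in> W n" "decseq W"
    and base: "\<And>V. openin T V \<Longrightarrow> c \<in> V \<Longrightarrow> \<exists>n. W n \<subseteq> V"
    and win: "Gfin_II_has_winning_strategy (omega_covers X) (omega_covers X)"
  shows "CFT_II_has_winning_strategy (Cp X T) (Cp_const X c)"
proof -
  obtain \<sigma> where strat: "Gfin_strategy_II (omega_covers X) \<sigma>"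
    and \<sigma>: "\<And>A. (\<And>n::nat. A n \<in> omega_covers X) \<Longrightarrow>
              (\<Union>n. \<sigma> (map A [0..<Suc n])) \<in> omega_covers X"
    using win unfolding Gfin_II_has_winning_strategy_def Gfin_winning_strategy_II_def by blast
  let ?\<Omega> = "Omega_at (Cp X T) (Cp_const X c)"
  define cov where
    "cov A n = {U. openin X U \<and> U \<noteq> topspace X \<and> (\<exists>f\<in>A. f ` U \<subseteq> W n)}"
    for A :: "('a \<Rightarrow> 'b) set" and n
  define pick where "pick A n U = (SOME f. f \<in> A \<and> f ` U \<subseteq> W n)"
    for A :: "('a \<Rightarrow> 'b) set" and n U
  have cov: "cov A n \<in> omega_covers X" if "A \<in> ?\<Omega>" for A n
    unfolding cov_def by (rule omega_cover_of_Omega_at[OF X c that W(1,2)])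
  have pick: "pick A n U \<in> A" "pick A n U ` U \<subseteq> W n" if "U \<in> cov A n" for A n U
  proof -
    have "\<exists>f. f \<in> A \<and> f ` U \<subseteq> W n"
      using that unfolding cov_def mem_Collect_eq Bex_def by (elim conjE)
    then have "pick A n U \<in> A \<and> pick A n U ` U \<subseteq> W n"
      unfolding pick_def by (rule someI_ex)
    then show "pick A n U \<in> A" "pick A n U ` U \<subseteq> W n"
      by simp_all
  qed
  \<comment> \<open>The translation depends on the inning: the move at index \<open>i\<close> is
    measured against \<open>W i\<close>. Indices start at 0, so the latest move has index
    \<open>length As - 1\<close>.\<close>
  define covs where "covs As = map (\<lambda>i. cov (As ! i) i) [0..<length As]" for As
  define \<tau> where "\<tau> As = pick (last As) (length As - 1) ` \<sigma> (covs As)" for As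
  have \<sigma>_covs: "finite (\<sigma> (covs As)) \<and> \<sigma> (covs As) \<subseteq> cov (last As) (length As - 1)"
    if As: "As \<noteq> []" "set As \<subseteq> ?\<Omega>" for As
  proof -
    have "set (covs As) \<subseteq> omega_covers X"
      by (auto simp: covs_def intro!: cov subsetD[OF As(2)])
    moreover have "covs As \<noteq> []" "last (covs As) = cov (last As) (length As - 1)"
      using As(1) by (auto simp: covs_def last_map last_conv_nth)
    ultimately show ?thesis
      using strat unfolding Gfin_strategy_II_def by metis
  qed
  have strat': "Gfin_strategy_II ?\<Omega> \<tau>"
    unfolding Gfin_strategy_II_def \<tau>_def using \<sigma>_covs pick(1) by blast
  have "(\<Union>n. \<tau> (map A [0..<Suc n])) \<in> ?\<Omega>" if A: "\<And>n. A n \<in> ?\<Omega>" for A :: "nat \<Rightarrow> _"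
  proof -
    define C where "C n = cov (A n) n" for n
    define B where "B n = \<sigma> (map C [0..<Suc n])" for n
    have covs: "covs (map A [0..<Suc n]) = map C [0..<Suc n]" for n
      unfolding covs_def C_def by (rule nth_equalityI) (auto simp del: upt_Suc)
    have B: "finite (B n)" "B n \<subseteq> C n" for n
      using \<sigma>_covs[of "map A [0..<Suc n]"] A unfolding covs B_def C_def by auto
    have \<tau>_eq: "\<tau> (map A [0..<Suc n]) = pick (A n) n ` B n" for n
      unfolding \<tau>_def covs B_def by simp
    have \<tau>_sub: "\<tau> (map A [0..<Suc n]) \<subseteq> A n" for n
      unfolding \<tau>_eq using pick(1) B(2) unfolding C_def by blast
    have B_cover: "(\<Union>n. B n) \<in> omega_covers X"
      unfolding B_def by (rule \<sigma>) (simp add: C_def cov A)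
    have "\<exists>f\<in>(\<Union>n. \<tau> (map A [0..<Suc n])). f ` F \<subseteq> V"
      if F: "finite F" "F \<subseteq> topspace X" and V: "openin T V" "c \<in> V" for F V
    proof -
      obtain m where m: "W m \<subseteq> V"
        using base V by blast
      \<comment> \<open>Sets chosen before inning \<open>m\<close> only come with some
        \<open>W n\<close> for \<open>n < m\<close>, which may stick out of \<open>V\<close>. There
        are finitely many of them, and each misses a point because members of an \<omega>-cover are
        proper.\<close>
      define early where "early = (\<Union>n<m. B n)"
      have "\<forall>U\<in>early. \<exists>x. x \<in> topspace X - U"
        using omega_covers_proper_subset[OF B_cover] unfolding early_def by blast
      then obtain p where p: "\<And>U. U \<in> early \<Longrightarrow> p U \<in> topspace X - U"
        by metis
      \<comment> \<open>The added points keep the covering set from being selected before inning \<open>m\<close>.\<close>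
      have "finite (F \<union> p ` early)" "F \<union> p ` early \<subseteq> topspace X"
        using F p B(1) by (auto simp: early_def)
      then obtain U where U: "U \<in> (\<Union>n. B n)" "F \<union> p ` early \<subseteq> U"
        by (rule omega_coversE[OF B_cover])
      then obtain n where n: "U \<in> B n"
        by blast
      have "U \<notin> early"
        using p U(2) by blast
      then have "m \<le> n"
        using n unfolding early_def by (meson UN_I lessThan_iff not_le)
      have "pick (A n) n U ` U \<subseteq> W n"
        using pick(2) B(2) n unfolding C_def by blast
      also have "\<dots> \<subseteq> V"
        using decseqD[OF W(3) \<open>m \<le> n\<close>] m by blast
      finally have "pick (A n) n U ` F \<subseteq> V"
        using U(2) by blast
      then show ?thesis
        using n unfolding \<tau>_eq by blast
    qed
    moreover have "(\<Union>n. \<tau> (map A [0..<Suc n])) \<subseteq> topspace (Cp X T)"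
      "Cp_const X c \<notin> (\<Union>n. \<tau> (map A [0..<Suc n]))"
      using \<tau>_sub A unfolding Omega_at_def by blast+
    ultimately show ?thesis
      unfolding Omega_at_Cp_const_iff[OF c] by simp
  qed
  with strat' show ?thesis
    unfolding CFT_II_has_winning_strategy_def Gfin_II_has_winning_strategy_def
      Gfin_winning_strategy_II_def by blast
qed

section \<open>From the function space to the covering game\<close>

text \<open>If \<open>U\<close> in \<open>\<U>\<close> contains the finite set \<open>F\<close>, a
  function into [0,1] that separates \<open>F\<close> from the complement of \<open>U\<close>,
  followed by the path \<open>\<gamma>\<close>, equals \<open>c\<close> on \<open>F\<close> and
  \<open>g\<close> outside \<open>U\<close>.\<close>

lemma Omega_at_of_omega_cover:
  assumes X: "completely_regular_space X"
    and \<gamma>: "continuous_map (top_of_set {0..1::real}) T \<gamma>" "\<gamma> 0 = c" "\<gamma> 1 = g" "g \<noteq> c"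
    and \<U>: "\<U> \<in> omega_covers X"
  shows "{f \<in> topspace (Cp X T). \<exists>U\<in>\<U>. \<forall>x\<in>topspace X - U. f x = g}
         \<in> Omega_at (Cp X T) (Cp_const X c)" (is "?A \<in> _")
proof -
  have c: "c \<in> topspace T"
    using continuous_map_funspace[OF \<gamma>(1)] \<gamma>(2) by force
  have "\<exists>f\<in>?A. f ` F \<subseteq> W"
    if F: "finite F" "F \<subseteq> topspace X" and W: "openin T W" "c \<in> W" for F W
  proof -
    obtain U where U: "U \<in> \<U>" "F \<subseteq> U"
      using omega_coversE[OF \<U> F] .
    have "closedin X (topspace X - U)"
      using \<U> U(1) unfolding omega_covers_iff by blast
    \<comment> \<open>Treating \<open>F\<close> as a compact set gives a single separating function,
      instead of one for each point of \<open>F\<close>.\<close>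
    moreover have "compactin X F"
      using F by (simp add: finite_imp_compactin)
    moreover have "disjnt (topspace X - U) F"
      using U(2) by (auto simp: disjnt_def)
    ultimately obtain h where h: "continuous_map X (top_of_set {0..1::real}) h"
      "h ` F \<subseteq> {0}" "h ` (topspace X - U) \<subseteq> {1}"
      using Urysohn_completely_regular_closed_compact[OF zero_le_one X] by metis
    \<comment> \<open>The restriction to \<open>topspace X\<close> is there because the points of
      \<open>Cp X T\<close> are extensional functions.\<close>
    define f where "f = (\<lambda>x\<in>topspace X. \<gamma> (h x))"
    have "continuous_map X T (\<gamma> \<circ> h)"
      using h(1) \<gamma>(1) by (rule continuous_map_compose)
    then have "continuous_map X T f"
      by (rule continuous_map_eq) (simp add: f_def)
    then have "f \<in> topspace (Cp X T)"
      by (simp add: topspace_Cp f_def)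
    moreover have "\<forall>x\<in>topspace X - U. f x = g"
      using h(3) \<gamma>(3) by (auto simp: f_def)
    moreover have "f ` F \<subseteq> W"
      using h(2) F(2) \<gamma>(2) W(2) by (auto simp: f_def)
    ultimately show ?thesis
      using U(1) by blast
  qed
  \<comment> \<open>Every \<open>U\<close> in \<open>\<U>\<close> is proper, so each function in the
    set takes the value \<open>g\<close>, which differs from \<open>c\<close>, somewhere.\<close>
  moreover have "Cp_const X c \<notin> ?A"
    using omega_covers_proper_subset[OF \<U>] \<gamma>(4) by (fastforce simp: Cp_const_def)
  ultimately show ?thesis
    unfolding Omega_at_Cp_const_iff[OF c] by auto
qed

text \<open>Each function chosen by \<open>\<tau>\<close> is traded for a member of the current
  cover outside which it is constantly \<open>g\<close>. If the function avoids \<open>g\<close> on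
  \<open>F\<close>, that member must contain \<open>F\<close>.\<close>

lemma Menger_strategy_of_CFT_strategy:
  assumes X: "completely_regular_space X"
    and T: "t1_space T"
    and \<gamma>: "continuous_map (top_of_set {0..1::real}) T \<gamma>" "\<gamma> 0 = c" "\<gamma> 1 = g" "g \<noteq> c"
    and win: "CFT_II_has_winning_strategy (Cp X T) (Cp_const X c)"
  shows "Gfin_II_has_winning_strategy (omega_covers X) (omega_covers X)"
proof -
  have c: "c \<in> topspace T" and g: "g \<in> topspace T"
    using continuous_map_funspace[OF \<gamma>(1)] \<gamma>(2,3) by force+
  let ?\<Omega> = "Omega_at (Cp X T) (Cp_const X c)"
  obtain \<tau> where strat: "Gfin_strategy_II ?\<Omega> \<tau>"
    and \<tau>: "\<And>A. (\<And>n::nat. A n \<in> ?\<Omega>) \<Longrightarrow> (\<Union>n. \<tau> (map A [0..<Suc n])) \<in> ?\<Omega>"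
    using win unfolding CFT_II_has_winning_strategy_def Gfin_II_has_winning_strategy_def
      Gfin_winning_strategy_II_def by blast
  define fns where
    "fns \<U> = {f \<in> topspace (Cp X T). \<exists>U\<in>\<U>. \<forall>x\<in>topspace X - U. f x = g}" for \<U>
  define pick where "pick \<U> f = (SOME U. U \<in> \<U> \<and> (\<forall>x\<in>topspace X - U. f x = g))" for \<U> f
  have fns: "fns \<U> \<in> ?\<Omega>" if "\<U> \<in> omega_covers X" for \<U>
    unfolding fns_def by (rule Omega_at_of_omega_cover[OF X \<gamma> that])
  have pick: "pick \<U> f \<in> \<U> \<and> (\<forall>x\<in>topspace X - pick \<U> f. f x = g)" if "f \<in> fns \<U>" for \<U> f
    unfolding pick_def by (rule someI_ex) (use that in \<open>auto simp: fns_def\<close>)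
  define \<sigma> where "\<sigma> Us = pick (last Us) ` \<tau> (map fns Us)" for Us
  have \<tau>_fns: "finite (\<tau> (map fns Us)) \<and> \<tau> (map fns Us) \<subseteq> fns (last Us)"
    if Us: "Us \<noteq> []" "set Us \<subseteq> omega_covers X" for Us
  proof -
    have "set (map fns Us) \<subseteq> ?\<Omega>"
      using Us(2) fns by auto
    then show ?thesis
      using strat Us(1) unfolding Gfin_strategy_II_def by (metis last_map map_is_Nil_conv)
  qed
  have strat': "Gfin_strategy_II (omega_covers X) \<sigma>"
    unfolding Gfin_strategy_II_def \<sigma>_def using \<tau>_fns pick by blast
  have "(\<Union>n. \<sigma> (map \<U> [0..<Suc n])) \<in> omega_covers X"
    if \<U>: "\<And>n. \<U> n \<in> omega_covers X" for \<U> :: "nat \<Rightarrow> _"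
  proof -
    define A where "A n = fns (\<U> n)" for n
    define B where "B n = \<tau> (map A [0..<Suc n])" for n
    have fns_map: "map fns (map \<U> [0..<Suc n]) = map A [0..<Suc n]" for n
      by (simp add: A_def)
    have \<sigma>_eq: "\<sigma> (map \<U> [0..<Suc n]) = pick (\<U> n) ` B n" for n
      unfolding \<sigma>_def fns_map B_def by simp
    have B: "B n \<subseteq> fns (\<U> n)" for n
      using \<tau>_fns[of "map \<U> [0..<Suc n]"] \<U> unfolding fns_map B_def by auto
    have \<sigma>_sub: "\<sigma> (map \<U> [0..<Suc n]) \<subseteq> \<U> n" for n
      unfolding \<sigma>_eq using pick B by blast
    have B_Omega: "(\<Union>n. B n) \<in> ?\<Omega>"
      unfolding B_def by (rule \<tau>) (simp add: A_def fns \<U>)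
    have "\<exists>U\<in>(\<Union>n. \<sigma> (map \<U> [0..<Suc n])). F \<subseteq> U"
      if F: "finite F" "F \<subseteq> topspace X" for F
    proof -
      \<comment> \<open>Avoiding \<open>g\<close> is an open condition satisfied by
        \<open>c\<close>, so accumulation at the constant \<open>c\<close> yields a chosen function
        that avoids \<open>g\<close> on all of \<open>F\<close>.\<close>
      have "openin T (topspace T - {g})"
        using T g by (simp add: t1_space_closedin_singleton openin_diff)
      moreover have "c \<in> topspace T - {g}"
        using c \<gamma>(4) by simp
      ultimately obtain f where f: "f \<in> (\<Union>n. B n)" "f ` F \<subseteq> topspace T - {g}"
        using Omega_at_Cp_constE[OF B_Omega c F] by metis
      then obtain n where n: "f \<in> B n"
        by blast
      have "F \<subseteq> pick (\<U> n) f"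
        using pick[of f "\<U> n"] B n f(2) F(2) by blast
      then show ?thesis
        using n unfolding \<sigma>_eq by blast
    qed
    moreover have "\<forall>U\<in>(\<Union>n. \<sigma> (map \<U> [0..<Suc n])). openin X U"
      "topspace X \<notin> (\<Union>n. \<sigma> (map \<U> [0..<Suc n]))"
      using \<sigma>_sub \<U> unfolding omega_covers_iff by blast+
    ultimately show ?thesis
      unfolding omega_covers_iff by blast
  qed
  with strat' show ?thesis
    unfolding Gfin_II_has_winning_strategy_def Gfin_winning_strategy_II_def by blast
qed

section \<open>Neighbourhood bases in metrizable spaces and the equivalence\<close>

text \<open>Balls of radius 1/(n+1) around \<open>c\<close> serve as the shrinking targets for
  successive innings. The shift by one is essential: \<open>inverse 0\<close> is 0, and a ball of
  radius 0 would be empty.\<close>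

lemma metrizable_space_decseq_base:
  assumes "metrizable_space T" "c \<in> topspace T"
  obtains W :: "nat \<Rightarrow> 'a set"
  where "\<And>n. openin T (W n)" "\<And>n. c \<in> W n" "decseq W"
    "\<And>V. openin T V \<Longrightarrow> c \<in> V \<Longrightarrow> \<exists>n. W n \<subseteq> V"
proof -
  obtain M d where M: "Metric_space M d" and T: "T = Metric_space.mtopology M d"
    using assms(1) unfolding metrizable_space_def by blast
  interpret Metric_space M d by (rule M)
  have c: "c \<in> M"
    using assms(2) T by simp
  show thesis
  proof
    fix n
    show "openin T (mball c (inverse (real (Suc n))))"
      by (simp add: T)
    show "c \<in> mball c (inverse (real (Suc n)))"
      using c by simp
  next
    show "decseq (\<lambda>n. mball c (inverse (real (Suc n))))"
      by (intro decseq_SucI mball_subset_concentric) (simp add: field_simps)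
  next
    fix V assume "openin T V" "c \<in> V"
    then obtain r where r: "r > 0" "mball c r \<subseteq> V"
      unfolding T openin_mtopology by blast
    then obtain n where "inverse (real (Suc n)) < r"
      using reals_Archimedean by blast
    then show "\<exists>n. mball c (inverse (real (Suc n))) \<subseteq> V"
      using r(2) mball_subset_concentric[of "inverse (real (Suc n))" r c] by fastforce
  qed
qed

text \<open>Both strategy translations are used at \<open>c = 0\<close>, the identity of the
  additively written group. Metrizability provides the decreasing base for one direction;
  non-triviality and arc-connectedness provide \<open>g\<close> and the path for the other.\<close>

theorem theorem3p1:
  fixes X :: "'a topology"
  assumes "infinite (topspace X)"
    and "Tychonoff_space X"
    and "(UNIV :: 'g::topological_group_add set) \<noteq> {0}"
    and "metrizable_space (euclidean :: 'g topology)"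
    and "arc_connected_space (euclidean :: 'g topology)"
  shows "Gfin_II_has_winning_strategy (omega_covers X) (omega_covers X) \<longleftrightarrow>
         CFT_II_has_winning_strategy (Cp X (euclidean :: 'g topology)) (Cp_const X 0)"
proof
  have X: "completely_regular_space X" "t1_space X"
    using assms(2) by (auto simp: Tychonoff_space_def Hausdorff_imp_t1_space)
  have T: "t1_space (euclidean :: 'g topology)"
    using assms(4) by (simp add: metrizable_imp_Hausdorff_space Hausdorff_imp_t1_space)
  {
    obtain W :: "nat \<Rightarrow> 'g set" where W: "\<And>n. openin euclidean (W n)" "\<And>n. 0 \<in> W n" "decseq W"
      "\<And>V. openin euclidean V \<Longrightarrow> 0 \<in> V \<Longrightarrow> \<exists>n. W n \<subseteq> V"
      using metrizable_space_decseq_base[OF assms(4), of 0] by (metis UNIV_I topspace_euclidean)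
    assume "Gfin_II_has_winning_strategy (omega_covers X) (omega_covers X)"
    then show "CFT_II_has_winning_strategy (Cp X (euclidean :: 'g topology)) (Cp_const X 0)"
      using CFT_strategy_of_Menger_strategy[OF assms(1) X(2) _ W] by simp
  next
    obtain g :: 'g where g: "g \<noteq> 0"
      using assms(3) by blast
    then obtain \<gamma> :: "real \<Rightarrow> 'g" where \<gamma>: "embedding_map (top_of_set {0..1}) euclidean \<gamma>"
      "\<gamma> 0 = 0" "\<gamma> 1 = g"
      using assms(5) unfolding arc_connected_space_def by (metis UNIV_I topspace_euclidean)
    \<comment> \<open>An embedding is a homeomorphism onto its image as a subspace; continuity into
      the whole group follows by enlarging the codomain.\<close>
    have \<gamma>_cont: "continuous_map (top_of_set {0..1}) euclidean \<gamma>"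
      using \<gamma>(1) unfolding embedding_map_def
      by (blast dest: homeomorphic_imp_continuous_map continuous_map_into_fulltopology)
    assume "CFT_II_has_winning_strategy (Cp X (euclidean :: 'g topology)) (Cp_const X 0)"
    then show "Gfin_II_has_winning_strategy (omega_covers X) (omega_covers X)"
      using Menger_strategy_of_CFT_strategy[OF X(1) T \<gamma>_cont \<gamma>(2,3) g] by simp
  }
qed

end
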